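(* Let $1\le d\le\infty$ and let $f:\mathbb{D}\to\mathbb{B}_d$ be a proper analytic map which extends to be $C^1$ on $\overline{\mathbb{D}}$. Then $f(\mathbb{D})$ meets the boundary of $\mathbb{B}_d$ transversally, i.e. $\langle f(z),f'(z)\rangle\neq 0$ for all $z\in\partial\mathbb{D}$. Indeed, $\langle f(z), f'(z)z\rangle>0$ for all $z\in\partial\mathbb{D}$.
   Context: $\mathbb{D}$ is the open unit disc in $\mathbb{C}$, and $\mathbb{B}_d$ is the open unit ball of $\mathbb{C}^d$ (of $\ell^2$ if $d=\infty$). A map $f:\mathbb{D}\to\mathbb{B}_d$ is called proper if $\lim_{|z|\to1}\|f(z)\|=1$. If a proper analytic map $f$ extends to be $C^1$ up to the boundary, its image is said to meet the boundary of $\mathbb{B}_d$ transversally at $f(z)$, $z\in\partial\mathbb{D}$, if $\langle f(z),f'(z)\rangle\ne0$ (here $f'$ denotes the extended complex derivative). *)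

theory Defs
  imports "HOL-Analysis.Analysis" "HOL-Library.Extended_Nat" "HOL-Library.Complex_Order"
begin

text \<open>
  The complex Hilbert space of square-summable sequences.  As a type it carries the library's
  \<^class>\<open>real_inner\<close> structure (the real part of the complex inner product), so that norm,
  limits, continuity and derivatives below are the library's notions.
\<close>

typedef ell2 = "{x :: nat \<Rightarrow> complex. summable (\<lambda>n. (cmod (x n))\<^sup>2)}"
  morphisms coord Abs_ell2
  by (rule exI[of _ "\<lambda>_. 0"]) simp

setup_lifting type_definition_ell2

lemma summable_coord: "summable (\<lambda>n. (cmod (coord x n))\<^sup>2)"
  using coord[of x] by simp

lemma ell2_eqI: "(\<And>n. coord x n = coord y n) \<Longrightarrow> x = y"
  by (simp add: coord_inject[symmetric] fun_eq_iff)

lemma summable_cmod_mult: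
  fixes x y :: "nat \<Rightarrow> complex"
  assumes "summable (\<lambda>n. (cmod (x n))\<^sup>2)" "summable (\<lambda>n. (cmod (y n))\<^sup>2)"
  shows "summable (\<lambda>n. cmod (x n) * cmod (y n))"
proof (rule summable_comparison_test')
  show "summable (\<lambda>n. (cmod (x n))\<^sup>2 + (cmod (y n))\<^sup>2)"
    by (rule summable_add[OF assms])
  fix n :: nat
  have "0 \<le> (cmod (x n) - cmod (y n))\<^sup>2"
    by simp
  then have "2 * (cmod (x n) * cmod (y n)) \<le> (cmod (x n))\<^sup>2 + (cmod (y n))\<^sup>2"
    by (simp add: power2_diff algebra_simps)
  moreover have "0 \<le> cmod (x n) * cmod (y n)"
    by simp
  ultimately show "norm (cmod (x n) * cmod (y n)) \<le> (cmod (x n))\<^sup>2 + (cmod (y n))\<^sup>2"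
    by (simp only: real_norm_def abs_of_nonneg)
qed

lemma summable_cmod_add:
  fixes x y :: "nat \<Rightarrow> complex"
  assumes "summable (\<lambda>n. (cmod (x n))\<^sup>2)" "summable (\<lambda>n. (cmod (y n))\<^sup>2)"
  shows "summable (\<lambda>n. (cmod (x n + y n))\<^sup>2)"
proof (rule summable_comparison_test')
  show "summable (\<lambda>n. (cmod (x n))\<^sup>2 + 2 * (cmod (x n) * cmod (y n)) + (cmod (y n))\<^sup>2)"
    by (intro summable_add summable_mult assms summable_cmod_mult)
  fix n :: nat
  have "(cmod (x n + y n))\<^sup>2 \<le> (cmod (x n) + cmod (y n))\<^sup>2"
    by (intro power_mono norm_triangle_ineq) simp
  then show "norm ((cmod (x n + y n))\<^sup>2)
      \<le> (cmod (x n))\<^sup>2 + 2 * (cmod (x n) * cmod (y n)) + (cmod (y n))\<^sup>2"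
    by (simp add: power2_sum algebra_simps)
qed

lemma summable_cmod_cmult:
  fixes c :: complex and x :: "nat \<Rightarrow> complex"
  assumes "summable (\<lambda>n. (cmod (x n))\<^sup>2)"
  shows "summable (\<lambda>n. (cmod (c * x n))\<^sup>2)"
  using summable_mult[OF assms, of "(cmod c)\<^sup>2"] by (simp add: norm_mult power_mult_distrib)

lift_definition scaleC :: "complex \<Rightarrow> ell2 \<Rightarrow> ell2"  (infixr "*\<^sub>C" 75)
  is "\<lambda>c x n. c * x n"
  by (rule summable_cmod_cmult)

definition cinner :: "ell2 \<Rightarrow> ell2 \<Rightarrow> complex" where
  "cinner x y = (\<Sum>n. coord x n * cnj (coord y n))"

lemma summable_cinner: "summable (\<lambda>n. coord x n * cnj (coord y n))"
  by (rule summable_norm_cancel)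
     (simp add: norm_mult summable_cmod_mult summable_coord)

instantiation ell2 :: real_inner
begin

lift_definition zero_ell2 :: ell2 is "\<lambda>_. 0"
  by simp

lift_definition plus_ell2 :: "ell2 \<Rightarrow> ell2 \<Rightarrow> ell2" is "\<lambda>x y n. x n + y n"
  by (rule summable_cmod_add)

lift_definition uminus_ell2 :: "ell2 \<Rightarrow> ell2" is "\<lambda>x n. - x n"
  by simp

definition minus_ell2_def:
  "x - y = x + (- y)" for x y :: ell2

definition scaleR_ell2_def:
  "r *\<^sub>R x = complex_of_real r *\<^sub>C x" for x :: ell2

definition inner_ell2_def:
  "inner x y = Re (cinner x y)" for x y :: ell2

definition norm_ell2_def:
  "norm x = sqrt (inner x x)" for x :: ell2

definition sgn_ell2_def:
  "sgn x = inverse (norm x) *\<^sub>R x" for x :: ell2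

definition dist_ell2_def:
  "dist x y = norm (x - y)" for x y :: ell2

definition uniformity_ell2_def:
  "(uniformity :: (ell2 \<times> ell2) filter) = (INF e\<in>{0<..}. principal {(x, y). dist x y < e})"

definition open_ell2_def:
  "open U \<longleftrightarrow> (\<forall>x\<in>U. \<forall>\<^sub>F (x', y) in uniformity. x' = x \<longrightarrow> y \<in> U)" for U :: "ell2 set"

instance
proof
  have Re_cinner: "Re (cinner x y) = (\<Sum>n. Re (coord x n * cnj (coord y n)))" for x y
    unfolding cinner_def by (rule bounded_linear.suminf[OF bounded_linear_Re summable_cinner])
  have sum_Re: "summable (\<lambda>n. Re (coord x n * cnj (coord y n)))" for x y
    by (rule summable_Re[OF summable_cinner])
  have coord_add: "coord (x + y) n = coord x n + coord y n" for x y n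
    by (simp add: plus_ell2.rep_eq)
  have coord_scaleR: "coord (r *\<^sub>R x) n = of_real r * coord x n" for r x n
    by (simp add: scaleR_ell2_def scaleC.rep_eq)
  have coord_uminus: "coord (- x) n = - coord x n" for x n
    by (simp add: uminus_ell2.rep_eq)
  have coord_zero: "coord 0 n = 0" for n
    by (simp add: zero_ell2.rep_eq)
  have inner_self: "inner x x = (\<Sum>n. (cmod (coord x n))\<^sup>2)" for x :: ell2
    unfolding inner_ell2_def Re_cinner by (simp add: complex_mult_cnj cmod_power2)
  fix x y z :: ell2 and r s :: real
  show "x + y + z = x + (y + z)" "x + y = y + x" "0 + x = x" "- x + x = 0"
    "r *\<^sub>R (x + y) = r *\<^sub>R x + r *\<^sub>R y" "(r + s) *\<^sub>R x = r *\<^sub>R x + s *\<^sub>R x"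
    "r *\<^sub>R s *\<^sub>R x = (r * s) *\<^sub>R x" "1 *\<^sub>R x = x"
    by (rule ell2_eqI, simp add: coord_add coord_scaleR coord_uminus coord_zero algebra_simps)+
  show "x - y = x + (- y)" by (rule minus_ell2_def)
  show "sgn x = inverse (norm x) *\<^sub>R x" by (rule sgn_ell2_def)
  show "dist x y = norm (x - y)" by (rule dist_ell2_def)
  show "(uniformity :: (ell2 \<times> ell2) filter) = (INF e\<in>{0<..}. principal {(x, y). dist x y < e})"
    by (rule uniformity_ell2_def)
  show "open U \<longleftrightarrow> (\<forall>x\<in>U. \<forall>\<^sub>F (x', y) in uniformity. x' = x \<longrightarrow> y \<in> U)" for U :: "ell2 set"
    by (rule open_ell2_def)
  show "inner x y = inner y x"
    unfolding inner_ell2_def Re_cinner by (simp add: algebra_simps)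
  show "inner (x + y) z = inner x z + inner y z"
    unfolding inner_ell2_def Re_cinner suminf_add[OF sum_Re sum_Re]
    by (simp add: coord_add algebra_simps)
  show "inner (r *\<^sub>R x) y = r * inner x y"
    unfolding inner_ell2_def Re_cinner suminf_mult[OF sum_Re, symmetric]
    by (simp add: coord_scaleR algebra_simps)
  show "0 \<le> inner x x"
    unfolding inner_self by (intro suminf_nonneg summable_coord) simp
  show "inner x x = 0 \<longleftrightarrow> x = 0"
  proof
    assume "inner x x = 0"
    then have "\<forall>n. (cmod (coord x n))\<^sup>2 = 0"
      unfolding inner_self using suminf_eq_zero_iff[OF summable_coord] by simp
    then show "x = 0"
      by (intro ell2_eqI) (simp add: coord_zero)
  next
    assume "x = 0"
    then show "inner x x = 0"
      unfolding inner_self by (simp add: coord_zero)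
  qed
  show "norm x = sqrt (inner x x)" by (rule norm_ell2_def)
qed

end

text \<open>
  For finite \<open>d\<close>, \<open>\<complex>\<^sup>d\<close> is identified with the sequences supported in \<open>{0..<d}\<close>; for
  \<open>d = \<infinity>\<close> there is no restriction on the support.
\<close>

definition cspace :: "enat \<Rightarrow> ell2 set" where
  "cspace d = {x. \<forall>n. d \<le> enat n \<longrightarrow> coord x n = 0}"

definition unit_ball :: "enat \<Rightarrow> ell2 set" where
  "unit_ball d = cspace d \<inter> ball 0 1"

text \<open>The complex derivative of a vector-valued function, with respect to the norm topology.\<close>

definition has_complex_derivative :: "(complex \<Rightarrow> ell2) \<Rightarrow> ell2 \<Rightarrow> complex filter \<Rightarrow> bool"
    (infix "has'_complex'_derivative" 50) where
  "(f has_complex_derivative v) F \<longleftrightarrow> (f has_derivative (\<lambda>h. h *\<^sub>C v)) F"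

definition analytic_on_disc :: "(complex \<Rightarrow> ell2) \<Rightarrow> bool" where
  "analytic_on_disc f \<longleftrightarrow> (\<forall>z\<in>ball 0 1. \<exists>v. (f has_complex_derivative v) (at z))"

definition proper_on_disc :: "(complex \<Rightarrow> ell2) \<Rightarrow> bool" where
  "proper_on_disc f \<longleftrightarrow> ((\<lambda>z. norm (f z)) \<longlongrightarrow> 1) (filtercomap cmod (at_left 1))"

text \<open>
  \<open>F\<close> and \<open>F'\<close> are the continuous extensions to the closed disc of \<open>f\<close> and of its complex
  derivative.
\<close>

definition C1_extension :: "(complex \<Rightarrow> ell2) \<Rightarrow> (complex \<Rightarrow> ell2) \<Rightarrow> (complex \<Rightarrow> ell2) \<Rightarrow> bool"
  where
  "C1_extension f F F' \<longleftrightarrow>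
     (\<forall>z\<in>ball 0 1. F z = f z \<and> (f has_complex_derivative F' z) (at z)) \<and>
     continuous_on (cball 0 1) F \<and> continuous_on (cball 0 1) F'"

definition meets_boundary_transversally :: "(complex \<Rightarrow> ell2) \<Rightarrow> (complex \<Rightarrow> ell2) \<Rightarrow> bool" where
  "meets_boundary_transversally F F' \<longleftrightarrow> (\<forall>z\<in>sphere 0 1. cinner (F z) (F' z) \<noteq> 0)"

end

theory Submission
  imports Defs "HOL-Complex_Analysis.Riemann_Mapping"
begin

text \<open>
  Fix a boundary point \<open>w\<close>.  Properness forces \<open>norm (F w) = 1\<close>.  Positivity of
  \<open>\<langle>F w, w F' w\<rangle>\<close> splits into a statement about its real part, which is the radial derivative
  of \<open>Re \<langle>F z, F w\<rangle>\<close> at \<open>w\<close>, and a statement about its imaginary part, which is a tangential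
  derivative.

  The real part is a Hopf boundary point phenomenon.  The scalar function
  \<open>g z = \<langle>f z, F w\<rangle>\<close> is a holomorphic self-map of the disc with boundary value \<open>1\<close> at \<open>w\<close>.  The
  Schwarz-Pick inequality between \<open>0\<close> and \<open>z\<close> shows that \<open>1 - \<bar>g z\<bar>\<close> is at least a fixed positive
  multiple of \<open>1 - \<bar>z\<bar>\<close> (lemma \<open>disc_self_map_boundary_gap\<close>), so \<open>Re g\<close> reaches the value \<open>1\<close>
  at the end of the radius to \<open>w\<close> with a strictly positive slope.

  The imaginary part vanishes because \<open>norm (F z) = 1\<close> on the whole circle, so that
  \<open>Re \<langle>F w, i w F' w\<rangle>\<close>, half the derivative of the squared norm along the circle, is \<open>0\<close>.

  Both derivatives are taken at a boundary point, where only the continuity of \<open>F'\<close> is given.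
  What makes them available is that a function whose derivative extends continuously to the
  boundary of a convex open set is differentiable there relative to the closure
  (lemma \<open>has_complex_derivative_boundary\<close>).
\<close>

section \<open>The complex structure of the sequence space\<close>

lemma coord_add: "coord (x + y) n = coord x n + coord y n"
  by (simp add: plus_ell2.rep_eq)

lemma coord_scaleR: "coord (r *\<^sub>R x) n = of_real r * coord x n"
  by (simp add: scaleR_ell2_def scaleC.rep_eq)

lemma coord_minus: "coord (x - y) n = coord x n - coord y n"
  unfolding minus_ell2_def plus_ell2.rep_eq uminus_ell2.rep_eq by simp

lemma cinner_add_left: "cinner (x + y) z = cinner x z + cinner y z"
  unfolding cinner_def suminf_add[OF summable_cinner summable_cinner]
  by (simp add: coord_add algebra_simps)

lemma cinner_scaleC_left: "cinner (c *\<^sub>C x) y = c * cinner x y"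
  unfolding cinner_def suminf_mult[OF summable_cinner, symmetric]
  by (simp add: scaleC.rep_eq algebra_simps)

lemma cinner_scaleC_right: "cinner x (c *\<^sub>C y) = cnj c * cinner x y"
  unfolding cinner_def suminf_mult[OF summable_cinner, symmetric]
  by (simp add: scaleC.rep_eq algebra_simps)

lemma cnj_cinner: "cnj (cinner x y) = cinner y x"
  unfolding cinner_def
  using bounded_linear.suminf[OF bounded_linear_cnj summable_cinner, of x y]
  by (simp add: mult.commute)

lemma cinner_self: "cinner x x = of_real ((norm x)\<^sup>2)"
proof -
  have "Im (cinner x x) = 0"
    using arg_cong[OF cnj_cinner[of x x], of Im] by simp
  moreover have "Re (cinner x x) = (norm x)\<^sup>2"
    by (simp add: power2_norm_eq_inner inner_ell2_def)
  ultimately show ?thesis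
    by (simp add: complex_eq_iff)
qed

lemma norm_scaleC: "norm (c *\<^sub>C x) = cmod c * norm x"
proof -
  have "complex_of_real ((norm (c *\<^sub>C x))\<^sup>2) = of_real ((cmod c * norm x)\<^sup>2)"
    unfolding cinner_self[symmetric] cinner_scaleC_left cinner_scaleC_right
    by (simp add: cinner_self power_mult_distrib complex_mult_cnj[of c] cmod_power2
        mult.commute[of "cnj c" c] flip: mult.assoc of_real_power)
  then have "(norm (c *\<^sub>C x))\<^sup>2 = (cmod c * norm x)\<^sup>2"
    by (simp only: of_real_eq_iff)
  then show ?thesis
    by (simp add: power2_eq_iff_nonneg)
qed

text \<open>
  Multiplying \<open>x\<close> by a unimodular scalar makes the complex inner product real, which reduces the
  inequality to the one for the real inner product.
\<close>

lemma cinner_Cauchy_Schwarz: "cmod (cinner x y) \<le> norm x * norm y"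
proof -
  obtain c where c: "cmod c = 1" "c * cinner x y = of_real (cmod (cinner x y))"
  proof (cases "cinner x y = 0")
    case True
    then show ?thesis using that[of 1] by simp
  next
    case False
    show ?thesis
      using False that[of "cnj (cinner x y) / of_real (cmod (cinner x y))"]
      by (simp add: norm_divide complex_norm_square[symmetric] power2_eq_square mult.commute)
  qed
  then have "cmod (cinner x y) = inner (c *\<^sub>C x) y"
    by (simp add: inner_ell2_def cinner_scaleC_left)
  also have "\<dots> \<le> norm (c *\<^sub>C x) * norm y"
    by (rule norm_cauchy_schwarz)
  finally show ?thesis
    by (simp add: norm_scaleC c)
qed

lemma bounded_linear_cinner_left: "bounded_linear (\<lambda>x. cinner x y)"
proof (rule bounded_linear_intro)
  show "cinner (r *\<^sub>R x) y = r *\<^sub>R cinner x y" for r x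
    by (simp add: scaleR_ell2_def cinner_scaleC_left scaleR_conv_of_real)
  show "norm (cinner x y) \<le> norm x * norm y" for x
    by (rule cinner_Cauchy_Schwarz)
qed (rule cinner_add_left)

lemma bounded_linear_scaleC_left: "bounded_linear (\<lambda>c. c *\<^sub>C x)"
proof (rule bounded_linear_intro)
  show "(a + b) *\<^sub>C x = a *\<^sub>C x + b *\<^sub>C x" for a b
    by (rule ell2_eqI) (simp add: coord_add scaleC.rep_eq algebra_simps)
  show "(r *\<^sub>R a) *\<^sub>C x = r *\<^sub>R (a *\<^sub>C x)" for r a
    by (rule ell2_eqI) (simp add: coord_scaleR scaleC.rep_eq scaleR_conv_of_real)
  show "norm (a *\<^sub>C x) \<le> norm a * norm x" for a
    by (simp add: norm_scaleC)
qed

lemma has_field_derivative_cinner: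
  assumes "(f has_complex_derivative v) (at z)"
  shows "((\<lambda>z. cinner (f z) y) has_field_derivative cinner v y) (at z)"
  using bounded_linear.has_derivative[OF bounded_linear_cinner_left
      assms[unfolded has_complex_derivative_def], of y]
  by (simp add: has_field_derivative_def cinner_scaleC_left mult.commute[of _ "cinner v y"])

section \<open>Differentiability up to the boundary\<close>

text \<open>
  Subtracting the candidate linear part leaves a function whose derivative is small near \<open>w\<close> inside
  \<open>U\<close>.  By the mean value inequality on the convex set \<open>U \<inter> ball w \<delta>\<close> it is Lipschitz with a small
  constant, and by continuity it remains so on the closure of this set, which contains every point
  of \<open>closure U\<close> close to \<open>w\<close>.
\<close>

lemma has_complex_derivative_boundary:
  assumes U: "open U" "convex U"
    and F: "continuous_on (closure U) F"
    and F': "continuous_on (closure U) F'"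
    and der: "\<And>z. z \<in> U \<Longrightarrow> (F has_complex_derivative F' z) (at z)"
    and w: "w \<in> closure U"
  shows "(F has_complex_derivative F' w) (at w within closure U)"
  unfolding has_complex_derivative_def has_derivative_within_alt
proof (intro conjI allI impI)
  show "bounded_linear (\<lambda>h. h *\<^sub>C F' w)"
    by (rule bounded_linear_scaleC_left)
  fix e :: real
  assume "0 < e"
  then obtain \<delta> where \<delta>: "0 < \<delta>"
    and small: "\<And>z. z \<in> closure U \<Longrightarrow> dist z w < \<delta> \<Longrightarrow> dist (F' z) (F' w) < e"
    using F' w unfolding continuous_on_iff by metis
  define S where "S = U \<inter> ball w \<delta>"
  define G where "G z = F z - z *\<^sub>C F' w" for z
  interpret L: bounded_linear "\<lambda>h. h *\<^sub>C F' w"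
    by (rule bounded_linear_scaleC_left)
  have "convex S"
    unfolding S_def using U by (simp add: convex_Int)
  have derG: "(G has_derivative (\<lambda>h. h *\<^sub>C (F' z - F' w))) (at z within S)" if "z \<in> S" for z
  proof -
    have "(G has_derivative (\<lambda>h. h *\<^sub>C F' z - h *\<^sub>C F' w)) (at z within S)"
      unfolding G_def
      using der[of z] that
      by (intro has_derivative_diff L.has_derivative has_derivative_ident)
         (auto simp: S_def has_complex_derivative_def intro: has_derivative_at_withinI)
    moreover have "h *\<^sub>C F' z - h *\<^sub>C F' w = h *\<^sub>C (F' z - F' w)" for h
      by (rule ell2_eqI) (simp add: coord_minus scaleC.rep_eq algebra_simps)
    ultimately show ?thesis
      by simp
  qed
  have small': "onorm (\<lambda>h. h *\<^sub>C (F' z - F' w)) \<le> e" if "z \<in> S" for z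
  proof (rule onorm_le)
    have "norm (F' z - F' w) \<le> e"
      using small[of z] that closure_subset[of U]
      by (auto simp: S_def dist_commute simp flip: dist_norm)
    then show "norm (h *\<^sub>C (F' z - F' w)) \<le> e * norm h" for h
      by (metis norm_scaleC mult.commute mult_left_mono norm_ge_zero)
  qed
  have "e-lipschitz_on S G"
    using differentiable_bound[OF \<open>convex S\<close> derG small'] \<open>0 < e\<close>
    by (intro lipschitz_onI) (auto simp: dist_norm)
  moreover have "continuous_on (closure S) G"
    unfolding G_def
    by (intro continuous_intros L.continuous_on continuous_on_subset[OF F] closure_mono)
       (simp add: S_def)
  ultimately have lip: "e-lipschitz_on (closure S) G"
    by (rule lipschitz_on_closure)
  have near: "y \<in> closure S" if "y \<in> closure U" "dist y w < \<delta>" for y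
    using open_Int_closure_subset[of "ball w \<delta>" U] that
    by (auto simp: S_def dist_commute Int_commute)
  show "\<exists>d>0. \<forall>y\<in>closure U. norm (y - w) < d \<longrightarrow>
      norm (F y - F w - (y - w) *\<^sub>C F' w) \<le> e * norm (y - w)"
  proof (intro exI[of _ \<delta>] conjI ballI impI \<delta>)
    fix y
    assume "y \<in> closure U" "norm (y - w) < \<delta>"
    then have "dist (G y) (G w) \<le> e * dist y w"
      using w \<delta> by (intro lipschitz_onD[OF lip] near) (auto simp: dist_norm)
    then show "norm (F y - F w - (y - w) *\<^sub>C F' w) \<le> e * norm (y - w)"
      by (simp add: G_def dist_norm L.diff algebra_simps)
  qed
qed

section \<open>Boundary behaviour of self-maps of the disc\<close>

lemma cmod_pseudo_hyperbolic_identity: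
  "(cmod (1 - cnj a * b))\<^sup>2 - (cmod (b - a))\<^sup>2 = (1 - (cmod a)\<^sup>2) * (1 - (cmod b)\<^sup>2)"
  unfolding cmod_power2 by (simp add: power2_eq_square algebra_simps)

text \<open>
  Composing \<open>g\<close> with the disc automorphism that sends \<open>a = g 0\<close> to \<open>0\<close> and applying the Schwarz lemma
  gives \<open>\<bar>g z - a\<bar> \<le> \<bar>z\<bar> \<bar>1 - cnj a * g z\<bar>\<close>.  Inserted into the identity above, this bounds
  \<open>1 - \<bar>g z\<bar>\<^sup>2\<close> below by \<open>(1 - \<bar>z\<bar>\<^sup>2) (1 - \<bar>a\<bar>)\<^sup>2\<close>.
\<close>

lemma disc_self_map_boundary_gap:
  assumes hol: "g holomorphic_on ball 0 1"
    and g: "\<And>z. cmod z < 1 \<Longrightarrow> cmod (g z) < 1"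
    and z: "cmod z < 1"
  shows "(1 - cmod (g 0))\<^sup>2 / 2 * (1 - cmod z) \<le> 1 - cmod (g z)"
proof -
  define a where "a = g 0"
  have a: "cmod a < 1"
    unfolding a_def by (rule g) simp
  define h where "h = Moebius_function 0 a \<circ> g"
  have "h holomorphic_on ball 0 1"
    unfolding h_def using g
    by (intro holomorphic_on_compose_gen[OF hol Moebius_function_holomorphic[OF a]]) auto
  moreover have "h 0 = 0"
    by (simp add: h_def a_def Moebius_function_eq_zero)
  moreover have "cmod (h u) < 1" if "cmod u < 1" for u
    unfolding h_def using Moebius_function_norm_lt_1[OF a g[OF that]] by simp
  ultimately have schwarz: "cmod (h z) \<le> cmod z"
    using Schwarz_Lemma(1)[of h z] z by simp
  have "cmod (cnj a * g z) \<le> cmod a"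
    using g[OF z] by (simp add: norm_mult mult_left_le)
  then have lower: "1 - cmod a \<le> cmod (1 - cnj a * g z)"
    using norm_triangle_ineq2[of 1 "cnj a * g z"] by simp
  then have "1 - cnj a * g z \<noteq> 0"
    using a by auto
  then have "cmod (g z - a) \<le> cmod z * cmod (1 - cnj a * g z)"
    using schwarz by (simp add: h_def Moebius_function_simple norm_divide pos_divide_le_eq)
  then have "(cmod (g z - a))\<^sup>2 \<le> (cmod z)\<^sup>2 * (cmod (1 - cnj a * g z))\<^sup>2"
    by (metis power_mono norm_ge_zero power_mult_distrib)
  then have "(1 - (cmod z)\<^sup>2) * (cmod (1 - cnj a * g z))\<^sup>2
      \<le> (1 - (cmod a)\<^sup>2) * (1 - (cmod (g z))\<^sup>2)"
    unfolding cmod_pseudo_hyperbolic_identity[symmetric] by (simp add: algebra_simps)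
  moreover have "(1 - (cmod z)\<^sup>2) * (1 - cmod a)\<^sup>2
      \<le> (1 - (cmod z)\<^sup>2) * (cmod (1 - cnj a * g z))\<^sup>2"
    using lower a z by (intro mult_left_mono power_mono) (auto simp: power_le_one)
  moreover have "(1 - (cmod a)\<^sup>2) * (1 - (cmod (g z))\<^sup>2) \<le> 1 - (cmod (g z))\<^sup>2"
    using a g[OF z] by (intro mult_left_le_one_le) (auto simp: power_le_one)
  moreover have "1 - (cmod (g z))\<^sup>2 \<le> 2 * (1 - cmod (g z))"
    using zero_le_power2[of "1 - cmod (g z)"] by (simp add: power2_diff)
  moreover have "(1 - cmod z) * (1 - cmod a)\<^sup>2 \<le> (1 - (cmod z)\<^sup>2) * (1 - cmod a)\<^sup>2"
    using z by (intro mult_right_mono) (auto simp: power2_eq_square mult_left_le)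
  ultimately show ?thesis
    by (simp add: a_def mult.commute)
qed

lemma left_derivative_ge_slope_bound:
  fixes q :: "real \<Rightarrow> real"
  assumes der: "(q has_field_derivative D) (at b within {a..b})"
    and "a < b"
    and bound: "\<And>r. a < r \<Longrightarrow> r < b \<Longrightarrow> q r \<le> q b - c * (b - r)"
  shows "c \<le> D"
proof (rule tendsto_lowerbound)
  show "((\<lambda>r. (q r - q b) / (r - b)) \<longlongrightarrow> D) (at_left b)"
    using der \<open>a < b\<close> by (simp add: has_field_derivative_iff at_within_Icc_at_left)
  show "\<forall>\<^sub>F r in at_left b. c \<le> (q r - q b) / (r - b)"
    using eventually_at_left_real[OF \<open>a < b\<close>]
  proof eventually_elim
    case (elim r)
    then have "q r \<le> q b - c * (b - r)"
      using bound by simp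
    with elim show ?case
      by (simp add: neg_le_divide_eq algebra_simps)
  qed
qed simp

section \<open>Proper maps into the ball\<close>

text \<open>
  Along the radius to \<open>w\<close> the norm of \<open>f\<close> tends to \<open>1\<close> by properness and to \<open>norm (F w)\<close> by
  continuity of the extension.
\<close>

lemma proper_extension_norm_sphere:
  assumes "proper_on_disc f" "continuous_on (cball 0 1) F"
    and eq: "\<And>z. z \<in> ball 0 1 \<Longrightarrow> F z = f z"
    and w: "w \<in> sphere 0 1"
  shows "norm (F w) = 1"
proof -
  have cw: "cmod (of_real r * w) = r" if "0 < r" for r
    using w that by (simp add: norm_mult)
  have ev: "\<forall>\<^sub>F r in at_left (1::real). 0 < r \<and> r < 1"
    using eventually_at_left_real[of 0 1] by (auto elim: eventually_mono)
  have "filterlim (\<lambda>r. of_real r * w) (filtercomap cmod (at_left 1)) (at_left (1::real))"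
    unfolding filterlim_filtercomap_iff
  proof (rule filterlim_cong[THEN iffD2, OF refl refl _ filterlim_ident])
    show "\<forall>\<^sub>F r in at_left (1::real). (cmod \<circ> (\<lambda>r. of_real r * w)) r = r"
      using ev by eventually_elim (use cw in auto)
  qed
  from filterlim_compose[OF assms(1)[unfolded proper_on_disc_def] this]
  have "((\<lambda>r. norm (f (of_real r * w))) \<longlongrightarrow> 1) (at_left (1::real))" .
  moreover have "\<forall>\<^sub>F r in at_left (1::real). norm (f (of_real r * w)) = norm (F (of_real r * w))"
    using ev by eventually_elim (simp add: eq cw)
  ultimately have "((\<lambda>r. norm (F (of_real r * w))) \<longlongrightarrow> 1) (at_left (1::real))"
    by (rule Lim_transform_eventually)
  moreover have "((\<lambda>r. norm (F (of_real r * w))) \<longlongrightarrow> norm (F w)) (at_left (1::real))"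
  proof -
    have "continuous_on {0..1} (\<lambda>r::real. norm (F (of_real r * w)))"
      using w by (intro continuous_intros continuous_on_compose2[OF assms(2)])
        (auto simp: norm_mult)
    then show ?thesis
      by (auto simp: continuous_on_def at_within_Icc_at_left dest: bspec[of _ _ 1])
  qed
  ultimately show ?thesis
    by (rule tendsto_unique[OF trivial_limit_at_left_real, symmetric])
qed

theorem corollary3p2:
  fixes d :: enat and f F F' :: "complex \<Rightarrow> ell2"
  assumes "1 \<le> d"
    and "f ` ball 0 1 \<subseteq> unit_ball d"
    and "analytic_on_disc f"
    and "proper_on_disc f"
    and "C1_extension f F F'"
  shows "meets_boundary_transversally F F' \<and>
    (\<forall>z\<in>sphere 0 1. 0 < cinner (F z) (z *\<^sub>C F' z))"
proof -
  have eq: "F z = f z" and derf: "(f has_complex_derivative F' z) (at z)"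
    if "z \<in> ball 0 1" for z
    using assms(5) that by (auto simp: C1_extension_def)
  have cF: "continuous_on (cball 0 1) F" and cF': "continuous_on (cball 0 1) F'"
    using assms(5) by (auto simp: C1_extension_def)
  have lt1: "norm (F z) < 1" if "z \<in> ball 0 1" for z
    using subsetD[OF assms(2) imageI[OF that]] eq[OF that] by (simp add: unit_ball_def)
  have eq1: "norm (F z) = 1" if "z \<in> sphere 0 1" for z
    by (rule proper_extension_norm_sphere[OF assms(4) cF eq that])
  have derF: "(F has_complex_derivative F' z) (at z)" if "z \<in> ball 0 1" for z
    using derf[OF that] that unfolding has_complex_derivative_def
    by (rule has_derivative_transform_within_open[OF _ open_ball]) (simp add: eq)
  have bd: "(F has_derivative (\<lambda>h. h *\<^sub>C F' z)) (at z within cball 0 1)"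
    if "z \<in> cball 0 1" for z
    using has_complex_derivative_boundary[of "ball 0 1" F F' z] cF cF' derF that
    by (simp add: has_complex_derivative_def)
  have pos: "0 < cinner (F w) (w *\<^sub>C F' w)" if w: "w \<in> sphere 0 1" for w
  proof -
    define D where "D = cinner (F w) (w *\<^sub>C F' w)"
    have D_inner: "inner (w *\<^sub>C F' w) (F w) = Re D"
      using inner_commute[of "w *\<^sub>C F' w" "F w"] by (simp add: D_def inner_ell2_def)
    have "0 < Re D"
    proof -
      define g where "g z = cinner (F z) (F w)" for z
      have g: "cmod (g z) < 1" if "cmod z < 1" for z
        using cinner_Cauchy_Schwarz[of "F z" "F w"] lt1[of z] eq1[OF w] that
        by (simp add: g_def)
      have "(g has_field_derivative cinner (F' z) (F w)) (at z)" if "z \<in> ball 0 1" for z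
        unfolding g_def by (rule has_field_derivative_cinner[OF derF[OF that]])
      then have hol: "g holomorphic_on ball 0 1"
        unfolding holomorphic_on_open[OF open_ball] by blast
      define c where "c = (1 - cmod (g 0))\<^sup>2 / 2"
      have "0 < c"
        using g[of 0] by (simp add: c_def)
      define q where "q r = inner (F (r *\<^sub>R w)) (F w)" for r
      have radius: "((\<lambda>r::real. r *\<^sub>R w) has_derivative (\<lambda>t. t *\<^sub>R w)) (at 1 within {0..1})"
        by (rule has_derivative_scaleR_left) (rule has_derivative_ident)
      have "((\<lambda>r. F (r *\<^sub>R w)) has_derivative (\<lambda>t. (t *\<^sub>R w) *\<^sub>C F' (1 *\<^sub>R w)))
          (at 1 within {0..1})"
        using w by (intro has_derivative_in_compose2[OF bd _ _ radius]) auto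
      then have "(q has_derivative (\<lambda>t. inner ((t *\<^sub>R w) *\<^sub>C F' w) (F w))) (at 1 within {0..1})"
        unfolding q_def scaleR_one by (rule has_derivative_inner_left)
      moreover have "inner ((t *\<^sub>R w) *\<^sub>C F' w) (F w) = Re D * t" for t
      proof -
        have "(t *\<^sub>R w) *\<^sub>C F' w = t *\<^sub>R (w *\<^sub>C F' w)"
          by (rule ell2_eqI) (simp add: coord_scaleR scaleC.rep_eq scaleR_conv_of_real)
        then show ?thesis
          by (simp add: D_inner)
      qed
      ultimately have "(q has_field_derivative Re D) (at 1 within {0..1})"
        by (simp add: has_field_derivative_def)
      moreover have "q r \<le> q 1 - c * (1 - r)" if "0 < r" "r < 1" for r
      proof -
        have r: "cmod (r *\<^sub>R w) = r"
          using w that by simp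
        have "q r = Re (g (r *\<^sub>R w))"
          by (simp add: q_def g_def inner_ell2_def)
        also have "\<dots> \<le> cmod (g (r *\<^sub>R w))"
          by (rule complex_Re_le_cmod)
        also have "\<dots> \<le> 1 - c * (1 - r)"
          using disc_self_map_boundary_gap[OF hol g, of "r *\<^sub>R w"] r that by (simp add: c_def)
        finally show ?thesis
          using eq1[OF w] by (simp add: q_def power2_norm_eq_inner[symmetric])
      qed
      ultimately have "c \<le> Re D"
        by (rule left_derivative_ge_slope_bound[OF _ zero_less_one])
      with \<open>0 < c\<close> show ?thesis
        by simp
    qed
    moreover have "Im D = 0"
    proof -
      have circle: "((\<lambda>t. cis t * w) has_derivative (\<lambda>t. (t *\<^sub>R \<i>) * w)) (at 0)"
        by (auto intro!: derivative_eq_intros)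
      have "((\<lambda>t. F (cis t * w)) has_derivative (\<lambda>t. (t *\<^sub>R \<i> * w) *\<^sub>C F' (cis 0 * w))) (at 0)"
        using w by (intro has_derivative_in_compose2[OF bd _ _ circle]) (auto simp: norm_mult)
      from has_derivative_inner[OF this this]
      have "((\<lambda>t. inner (F (cis t * w)) (F (cis t * w))) has_derivative
          (\<lambda>t. 2 * inner (F w) ((t *\<^sub>R \<i> * w) *\<^sub>C F' w))) (at 0)"
        by (simp add: inner_commute[of _ "F w"])
      moreover have "inner (F (cis t * w)) (F (cis t * w)) = 1" for t
        using eq1[of "cis t * w"] w
        by (simp add: norm_mult power2_norm_eq_inner[symmetric])
      ultimately have "((\<lambda>_. 1) has_derivative
          (\<lambda>t. 2 * inner (F w) ((t *\<^sub>R \<i> * w) *\<^sub>C F' w))) (at (0::real))"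
        by simp
      then have "(\<lambda>t. 2 * inner (F w) ((t *\<^sub>R \<i> * w) *\<^sub>C F' w)) = (\<lambda>_. 0)"
        by (rule has_derivative_unique[OF _ has_derivative_const])
      from fun_cong[OF this, of 1] have "inner (F w) ((\<i> * w) *\<^sub>C F' w) = 0"
        by simp
      \<comment> \<open>The inner product is conjugate linear in its second argument, so the left-hand side is
        \<open>Re (- \<i> * D) = Im D\<close>.\<close>
      then show ?thesis
        by (simp add: inner_ell2_def cinner_scaleC_right D_def)
    qed
    ultimately show ?thesis
      by (simp add: D_def less_complex_def)
  qed
  have "cinner (F z) (F' z) \<noteq> 0" if "z \<in> sphere 0 1" for z
    using pos[OF that] by (auto simp: cinner_scaleC_right)
  with pos show ?thesis
    by (simp add: meets_boundary_transversally_def)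
qed

end
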